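(* Let $a,b,c,d,e$ be complex parameters with $\Re(d+e-a-b-c)>0$ and such that $d-a$ or $d-b$ is a negative integer. Then $$F_{1:1}^{0:3}\left[{-\atop d}:{a,b,c\atop e};{d-a,d-b,e-c-1\atop d+e-a-b-c};1,1\right]=\frac{\Gamma(1-a)\,\Gamma(1-b)\,\Gamma(e)\,\Gamma(e-d)\,\Gamma(d+e-a-b-c)}{\Gamma(1-d)\,\Gamma(e-a)\,\Gamma(e-b)\,\Gamma(e-c)\,\Gamma(1+d-a-b)}.$$
   Context: $(x)_m=x(x+1)\cdots(x+m-1)$, $(x)_0=1$, is the Pochhammer symbol, and $(x_1,\dots,x_r)_m=(x_1)_m\cdots(x_r)_m$. The Kampé de Fériet series is $$F_{1:1}^{0:3}\left[{-\atop d}:{a,b,c\atop e};{a',b',c'\atop e'};x,y\right]=\sum_{m,n=0}^\infty\frac{(a,b,c)_m(a',b',c')_n}{(d)_{m+n}(e)_m(e')_n}\frac{x^my^n}{m!\,n!}.$$ It is absolutely convergent for $|x|=|y|=1$ when $\Re(d+e-a-b-c)>0$ and $\Re(d+e'-a'-b'-c')>0$. It is understood that no denominator parameter of the series ($d$, $e$, $e'$) is zero or a negative integer. It is also understood that the right-hand side is well defined, i.e. that no Gamma function in its numerator is evaluated at zero or a negative integer; in the denominator, $1/\Gamma$ is taken to be $0$ at such points. *)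

theory Defs
  imports "HOL-Analysis.Analysis"
begin

definition kdf_term ::
  "complex \<Rightarrow> complex \<Rightarrow> complex \<Rightarrow> complex \<Rightarrow> complex \<Rightarrow> complex \<Rightarrow> complex \<Rightarrow> complex \<Rightarrow> complex
    \<Rightarrow> complex \<Rightarrow> complex \<Rightarrow> nat \<times> nat \<Rightarrow> complex" where
  "kdf_term d a b c e a' b' c' e' x y = (\<lambda>(m, n).
     (pochhammer a m * pochhammer b m * pochhammer c m
        * (pochhammer a' n * pochhammer b' n * pochhammer c' n))
     / (pochhammer d (m + n) * pochhammer e m * pochhammer e' n)
     * (x ^ m * y ^ n / (fact m * fact n)))"

text \<open>
  The value of the Kampe de Feriet series with upper/lower index \<open>0:3\<close>/\<open>1:1\<close>, parameters
  \<open>[- ; d : a,b,c ; e : a',b',c' ; e']\<close>. The double series is read as an unordered sum over all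
  pairs \<open>(m, n)\<close>, which for complex terms is the same as absolute convergence; without
  convergence \<^const>\<open>infsum\<close> is \<open>0\<close>, so summability has to be asserted separately.
\<close>
definition kdf ::
  "complex \<Rightarrow> complex \<Rightarrow> complex \<Rightarrow> complex \<Rightarrow> complex \<Rightarrow> complex \<Rightarrow> complex \<Rightarrow> complex \<Rightarrow> complex
    \<Rightarrow> complex \<Rightarrow> complex \<Rightarrow> complex" where
  "kdf d a b c e a' b' c' e' x y = (\<Sum>\<^sub>\<infinity>p. kdf_term d a b c e a' b' c' e' x y p)"

text \<open>
  The library's \<^const>\<open>Gamma\<close> is \<open>0\<close> at its poles and division by \<open>0\<close> yields \<open>0\<close>. Hence a quotient with
  \<open>Gamma z\<close> in the denominator agrees with the convention \<open>1 / Gamma z = 0\<close> at the poles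
  (this is the entire function \<^const>\<open>rGamma\<close>), whereas poles in a numerator must be excluded
  by hypothesis.
\<close>
lemma divide_Gamma_at_pole: "z \<in> \<int>\<^sub>\<le>\<^sub>0 \<Longrightarrow> w / Gamma (z :: complex) = 0"
  by (simp add: Gamma_nonpos_Int)

end

theory Submission
  imports Defs
begin

text \<open>
  Both sides are symmetric under exchanging \<open>a\<close> and \<open>b\<close>, so let \<open>d - a = - N\<close> and put
  \<open>f = e - b - c - N\<close>, the second lower parameter. The factor \<open>(d - a)\<^sub>n = (- N)\<^sub>n\<close> then cuts the
  sum over \<open>n\<close> off at \<open>N\<close>, and for \<open>n \<le> N\<close> the quotient \<open>(a)\<^sub>m / (d)\<^bsub>m+n\<^esub>\<close> becomes the polynomial
  \<open>(d + n + m)\<^bsub>N-n\<^esub> / (d)\<^sub>N\<close> in \<open>m\<close> (lemma \<open>kdf_term_eq\<close>).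

  The idea is to expand this polynomial by the binomial formula for rising factorials in the
  particular basis \<open>(b + m)\<^sub>j\<close>, with coefficients containing \<open>(d + n - b)\<^bsub>N-n-j\<^esub>\<close>. This choice does two
  things at once. Since \<open>(b)\<^sub>m (b + m)\<^sub>j = (b)\<^sub>j (b + j)\<^sub>m\<close>, the sum over \<open>m\<close> is again a Gauss
  hypergeometric series at \<open>1\<close>, with \<open>b\<close> replaced by \<open>b + j\<close> (lemma
  \<open>has_sum_pochhammer_hyp_term\<close>). And the coefficient combines with the factor \<open>(d - b)\<^sub>n\<close> of the
  series to \<open>(d - b)\<^bsub>N-j\<^esub>\<close>, which does not depend on \<open>n\<close>; the sum over \<open>n\<close> is therefore a
  Chu--Vandermonde sum, and the remaining sum over \<open>j\<close> is a binomial one (lemma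
  \<open>double_sum_eval\<close>). Absolute convergence comes for free, because only finitely many Gauss series
  are involved and \<open>Re f > 0\<close> makes each of them converge absolutely.

  The analytic ingredient is Gauss's theorem (lemma \<open>has_sum_hyp_term\<close>). The contiguous relation
  between the lower parameters \<open>c\<close> and \<open>c + 1\<close> follows by telescoping; iterated \<open>n\<close> times it expresses
  the value at \<open>c\<close> by Pochhammer symbols and the value at \<open>c + n\<close>. As \<open>n\<close> tends to infinity, the
  latter tends to \<open>1\<close>, and the Pochhammer symbols tend to the Gamma quotient by Euler's limit.
\<close>

section \<open>Gauss's theorem for the hypergeometric series at 1\<close>

definition hyp_term :: "complex \<Rightarrow> complex \<Rightarrow> complex \<Rightarrow> nat \<Rightarrow> complex" where
  "hyp_term a b c m = pochhammer a m * pochhammer b m / (pochhammer c m * fact m)"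

lemma pochhammer_nonzero:
  "(c::complex) \<notin> \<int>\<^sub>\<le>\<^sub>0 \<Longrightarrow> pochhammer c m \<noteq> 0"
  using pochhammer_eq_0_imp_nonpos_Int by blast

lemma add_of_nat_not_nonpos_Int:
  assumes "(c::complex) \<notin> \<int>\<^sub>\<le>\<^sub>0"
  shows "c + of_nat n \<notin> \<int>\<^sub>\<le>\<^sub>0"
proof
  assume "c + of_nat n \<in> \<int>\<^sub>\<le>\<^sub>0"
  then obtain k where "c + of_nat n = - of_nat k" by (rule nonpos_Ints_cases')
  then have "c = - of_nat (k + n)" by (simp add: algebra_simps eq_neg_iff_add_eq_0)
  then show False using assms by (metis minus_of_nat_in_nonpos_Ints)
qed

lemma Re_pos_not_nonpos_Int: "Re z > 0 \<Longrightarrow> z \<notin> \<int>\<^sub>\<le>\<^sub>0"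
  by (auto elim!: nonpos_Ints_cases)

text \<open>
  In this form the known limit of \<^const>\<open>rGamma_series\<close> gives the size of the terms,
  \<open>m\<^bsup>a+b-c-1\<^esup>\<close> up to a constant, without Stirling's formula.
\<close>
lemma hyp_term_asymp:
  assumes "c \<notin> \<int>\<^sub>\<le>\<^sub>0"
  shows "of_nat (Suc m) * hyp_term a b c (Suc m)
    = rGamma_series a m * rGamma_series b m / rGamma_series c m
      * exp ((a + b - c) * of_real (ln (of_nat m)))"
  using pochhammer_nonzero[OF assms, of "Suc m"]
  by (simp add: hyp_term_def rGamma_series_def field_simps exp_add exp_diff del: of_nat_Suc)

lemma norm_hyp_term_bound:
  assumes "c \<notin> \<int>\<^sub>\<le>\<^sub>0"
  shows "\<exists>K\<ge>0. \<forall>m\<ge>1. norm (of_nat (Suc m) * hyp_term a b c (Suc m))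
           \<le> K * real m powr Re (a + b - c)"
proof -
  have "(\<lambda>m. rGamma_series a m * rGamma_series b m / rGamma_series c m)
          \<longlonglongrightarrow> rGamma a * rGamma b / rGamma c"
    using assms by (intro tendsto_intros) (auto simp: rGamma_eq_zero_iff)
  then have "Bseq (\<lambda>m. rGamma_series a m * rGamma_series b m / rGamma_series c m)"
    by (rule convergentI[THEN convergent_imp_Bseq])
  then obtain K where K: "K > 0"
    "\<And>m. norm (rGamma_series a m * rGamma_series b m / rGamma_series c m) \<le> K"
    unfolding Bseq_def by auto
  have "norm (of_nat (Suc m) * hyp_term a b c (Suc m)) \<le> K * real m powr Re (a + b - c)"
    if "m \<ge> 1" for m
  proof -
    have "norm (exp ((a + b - c) * of_real (ln (of_nat m)))) = real m powr Re (a + b - c)"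
      using that by (simp add: powr_def)
    then show ?thesis
      using K(2)[of m] unfolding hyp_term_asymp[OF assms] norm_mult[of "_ / _"]
      by (simp add: mult_right_mono)
  qed
  with K(1) show ?thesis by (intro exI[of _ K]) auto
qed

lemma summable_norm_hyp_term:
  assumes c: "c \<notin> \<int>\<^sub>\<le>\<^sub>0" and s: "Re (c - a - b) > 0"
  shows "summable (\<lambda>m. norm (hyp_term a b c m))"
proof -
  obtain K where K: "K \<ge> 0" "\<And>m. m \<ge> 1 \<Longrightarrow> norm (of_nat (Suc m) * hyp_term a b c (Suc m))
           \<le> K * real m powr Re (a + b - c)"
    using norm_hyp_term_bound[OF c] by blast
  have "summable (\<lambda>m. norm (hyp_term a b c (Suc m)))"
  proof (rule summable_comparison_test)
    show "\<exists>N. \<forall>m\<ge>N. norm (norm (hyp_term a b c (Suc m))) \<le> K * real m powr (Re (a + b - c) - 1)"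
    proof (intro exI[of _ 1] allI impI)
      fix m :: nat assume m: "m \<ge> 1"
      have "real m * norm (hyp_term a b c (Suc m)) \<le> real (Suc m) * norm (hyp_term a b c (Suc m))"
        by (intro mult_right_mono) auto
      also have "\<dots> \<le> K * real m powr Re (a + b - c)"
        using K(2)[OF m] by (simp add: norm_mult del: of_nat_Suc)
      finally show "norm (norm (hyp_term a b c (Suc m))) \<le> K * real m powr (Re (a + b - c) - 1)"
        using m unfolding powr_diff by (simp add: pos_le_divide_eq mult.commute del: of_nat_Suc)
    qed
    show "summable (\<lambda>m. K * real m powr (Re (a + b - c) - 1))"
      using s by (intro summable_mult) (simp add: summable_real_powr_iff)
  qed
  then show ?thesis by (rule summable_Suc_iff[THEN iffD1])
qed

text \<open>The boundary term at infinity of the telescoping sum in the contiguous relation.\<close>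
lemma hyp_term_boundary:
  assumes c: "c \<notin> \<int>\<^sub>\<le>\<^sub>0" and s: "Re (c - a - b) > 0"
  shows "(\<lambda>m. of_nat m * hyp_term a b c m) \<longlonglongrightarrow> 0"
proof -
  obtain K where K: "K \<ge> 0" "\<And>m. m \<ge> 1 \<Longrightarrow> norm (of_nat (Suc m) * hyp_term a b c (Suc m))
           \<le> K * real m powr Re (a + b - c)"
    using norm_hyp_term_bound[OF c] by blast
  have "(\<lambda>m. real m powr Re (a + b - c)) \<longlonglongrightarrow> 0"
    using s by (intro tendsto_neg_powr filterlim_real_sequentially) auto
  then have "(\<lambda>m. K * real m powr Re (a + b - c)) \<longlonglongrightarrow> 0"
    using tendsto_mult_right_zero by blast
  then have "(\<lambda>m. of_nat (Suc m) * hyp_term a b c (Suc m)) \<longlonglongrightarrow> 0"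
    by (rule Lim_null_comparison[rotated]) (use K(2) in \<open>auto intro: eventually_sequentiallyI[of 1]\<close>)
  then show ?thesis by (rule LIMSEQ_imp_Suc)
qed

text \<open>
  With \<open>t\<^sub>m\<close> and \<open>t'\<^sub>m\<close> the terms for the lower parameters \<open>c\<close> and \<open>c + 1\<close>, the difference
  \<open>c (c - a - b) t\<^sub>m - (c - a) (c - b) t'\<^sub>m\<close> is the forward difference of \<open>- c m t\<^sub>m\<close>, which vanishes
  at \<open>m = 0\<close> and at infinity.
\<close>
lemma suminf_hyp_term_contiguous:
  assumes c: "c \<notin> \<int>\<^sub>\<le>\<^sub>0" and s: "Re (c - a - b) > 0"
  shows "c * (c - a - b) * suminf (hyp_term a b c)
       = (c - a) * (c - b) * suminf (hyp_term a b (c + 1))"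
proof -
  have c1: "c + 1 \<notin> \<int>\<^sub>\<le>\<^sub>0"
    using c by (metis plus_one_in_nonpos_Ints_imp)
  have step: "c * (c - a - b) * hyp_term a b c m - (c - a) * (c - b) * hyp_term a b (c + 1) m
      = (- c) * (of_nat (Suc m) * hyp_term a b c (Suc m)) - (- c) * (of_nat m * hyp_term a b c m)" for m
  proof -
    have nz: "c + of_nat m \<noteq> 0" "c \<noteq> 0" "pochhammer c m \<noteq> 0"
      using pochhammer_nonzero[OF c, of "Suc m"] pochhammer_nonzero[OF c, of m] c
      by (auto simp: pochhammer_Suc)
    have p1: "c * pochhammer (c + 1) m = pochhammer c m * (c + of_nat m)"
      using pochhammer_rec[of c m] pochhammer_Suc[of c m] by simp
    have t1: "(c + of_nat m) * hyp_term a b (c + 1) m = c * hyp_term a b c m"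
    proof -
      have "(c + of_nat m) * (pochhammer a m * pochhammer b m) * (pochhammer c m * fact m)
          = c * (pochhammer a m * pochhammer b m) * (pochhammer (c + 1) m * fact m)"
        using p1 by algebra
      then show ?thesis
        using nz pochhammer_nonzero[OF c1, of m] unfolding hyp_term_def times_divide_eq_right
        by (subst frac_eq_eq) simp_all
    qed
    have t2: "(c + of_nat m) * (of_nat (Suc m) * hyp_term a b c (Suc m))
        = (a + of_nat m) * (b + of_nat m) * hyp_term a b c m"
    proof -
      have "(of_nat (Suc m) :: complex) \<noteq> 0" by (rule of_nat_neq_0)
      then show ?thesis
        using nz unfolding hyp_term_def pochhammer_Suc fact_Suc times_divide_eq_right
        by (subst frac_eq_eq) (simp_all add: mult_ac del: of_nat_Suc)
    qed
    have "(c + of_nat m) * (c * (c - a - b) * hyp_term a b c m - (c - a) * (c - b) * hyp_term a b (c + 1) m)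
        = (c + of_nat m) * ((- c) * (of_nat (Suc m) * hyp_term a b c (Suc m)) - (- c) * (of_nat m * hyp_term a b c m))"
      using t1 t2 by algebra
    then show ?thesis using nz(1) by (metis mult_left_cancel)
  qed
  have "(\<lambda>m. (- c) * (of_nat m * hyp_term a b c m)) \<longlonglongrightarrow> (- c) * 0"
    by (intro tendsto_intros hyp_term_boundary assms)
  from telescope_sums[OF this]
  have "(\<lambda>m. c * (c - a - b) * hyp_term a b c m - (c - a) * (c - b) * hyp_term a b (c + 1) m) sums 0"
    unfolding step by simp
  moreover have "(\<lambda>m. c * (c - a - b) * hyp_term a b c m - (c - a) * (c - b) * hyp_term a b (c + 1) m)
     sums (c * (c - a - b) * suminf (hyp_term a b c) - (c - a) * (c - b) * suminf (hyp_term a b (c + 1)))"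
    using c c1 s
    by (intro sums_diff sums_mult summable_sums summable_norm_cancel[OF summable_norm_hyp_term]) auto
  ultimately show ?thesis using sums_unique2 by fastforce
qed

lemma suminf_hyp_term_shift:
  assumes c: "c \<notin> \<int>\<^sub>\<le>\<^sub>0" and s: "Re (c - a - b) > 0"
  shows "pochhammer c n * pochhammer (c - a - b) n * suminf (hyp_term a b c)
       = pochhammer (c - a) n * pochhammer (c - b) n * suminf (hyp_term a b (c + of_nat n))"
proof (induction n)
  case (Suc n)
  have cn: "c + of_nat n \<notin> \<int>\<^sub>\<le>\<^sub>0"
    using c by (rule add_of_nat_not_nonpos_Int)
  have "(c + of_nat n) * (c + of_nat n - a - b) * suminf (hyp_term a b (c + of_nat n))
      = (c + of_nat n - a) * (c + of_nat n - b) * suminf (hyp_term a b (c + of_nat n + 1))"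
    using s by (intro suminf_hyp_term_contiguous cn) auto
  moreover have "c + of_nat (Suc n) = c + of_nat n + 1" by simp
  ultimately show ?case using Suc.IH unfolding pochhammer_Suc by algebra
qed simp

lemma inverse_pochhammer_shift_tendsto_0:
  "(\<lambda>n. inverse (pochhammer ((c::complex) + of_nat n) (Suc k))) \<longlonglongrightarrow> 0"
proof (induction k)
  have lim: "(\<lambda>n. inverse (x + of_nat n)) \<longlonglongrightarrow> 0" for x :: complex
    by (rule filterlim_compose[OF tendsto_inverse_0])
       (intro tendsto_add_filterlim_at_infinity[OF tendsto_const] tendsto_of_nat)
  {
    case 0
    show ?case using lim[of c] by simp
  next
    case (Suc k)
    have "(\<lambda>n. inverse (pochhammer (c + of_nat n) (Suc k)) * inverse (c + of_nat (Suc k) + of_nat n))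
            \<longlonglongrightarrow> 0 * 0"
      by (intro tendsto_mult Suc.IH lim)
    then show ?case by (simp add: pochhammer_Suc[of _ "Suc k"] add_ac)
  }
qed

text \<open>
  Gives a majorant for the hypergeometric terms that is uniform in all lower parameters far enough
  to the right.
\<close>
lemma norm_pochhammer_mono_Re:
  assumes "r \<ge> 0" "r \<le> Re z"
  shows "norm (pochhammer (of_real r :: complex) m) \<le> norm (pochhammer z m)"
proof (induction m)
  case (Suc m)
  have "norm (of_real r + of_nat m :: complex) = r + real m"
    using assms by (metis abs_of_nonneg add_nonneg_nonneg norm_of_real of_nat_0_le_iff of_real_add of_real_of_nat_eq)
  also have "\<dots> \<le> Re (z + of_nat m)" using assms by simp
  also have "\<dots> \<le> norm (z + of_nat m)" by (rule complex_Re_le_cmod)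
  finally show ?case using Suc.IH by (simp add: pochhammer_Suc norm_mult mult_mono)
qed simp

text \<open>
  Every term but the one with \<open>m = 0\<close> vanishes in the limit. Tannery's theorem permits exchanging
  limit and sum; the majorant is a convergent hypergeometric series with a real lower parameter.
\<close>
lemma suminf_hyp_term_tendsto_1:
  "(\<lambda>n. suminf (hyp_term a b (c + of_nat n))) \<longlonglongrightarrow> 1"
proof -
  \<comment> \<open>Beyond \<open>n1\<close> the lower parameter has positive real part and the majorant converges.\<close>
  obtain n1 :: nat where n1: "real n1 > max (- Re c) (Re a + Re b - Re c)"
    using reals_Archimedean2 by blast
  define r where "r = Re c + real n1"
  have r: "r > 0" "r > Re a + Re b" using n1 by (auto simp: r_def)
  have rc: "of_real r \<notin> (\<int>\<^sub>\<le>\<^sub>0 :: complex set)"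
    using r(1) by (metis of_real_in_nonpos_Ints_iff nonpos_Ints_nonpos not_less)
  have "(\<lambda>n. \<Sum>k. hyp_term a b (c + of_nat n) k) \<longlonglongrightarrow> (\<Sum>k. if k = 0 then 1 else 0)"
  proof (rule tannerys_theorem[THEN conjunct2, THEN conjunct2])
    show "summable (\<lambda>k. norm (hyp_term a b (of_real r) k))"
      using r by (intro summable_norm_hyp_term rc) auto
    show "(\<lambda>n. hyp_term a b (c + of_nat n) k) \<longlonglongrightarrow> (if k = 0 then 1 else 0)" for k
    proof (cases k)
      case (Suc k')
      have "(\<lambda>n. pochhammer a k * pochhammer b k / fact k * inverse (pochhammer (c + of_nat n) (Suc k')))
              \<longlonglongrightarrow> pochhammer a k * pochhammer b k / fact k * 0"
        by (intro tendsto_intros inverse_pochhammer_shift_tendsto_0)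
      then show ?thesis by (simp add: hyp_term_def Suc field_simps)
    qed (simp add: hyp_term_def)
    have "norm (hyp_term a b (c + of_nat n) k) \<le> norm (hyp_term a b (of_real r) k)" if "n \<ge> n1" for n k
    proof -
      have "norm (pochhammer (of_real r :: complex) k) \<le> norm (pochhammer (c + of_nat n) k)"
        using r(1) that by (intro norm_pochhammer_mono_Re) (auto simp: r_def)
      moreover have "norm (pochhammer (of_real r :: complex) k) > 0"
        using pochhammer_nonzero[OF rc] by simp
      ultimately show ?thesis
        unfolding hyp_term_def norm_divide norm_mult
        by (intro divide_left_mono mult_right_mono mult_pos_pos) auto
    qed
    then show "\<forall>\<^sub>F (k, n) in sequentially \<times>\<^sub>F sequentially.
        norm (hyp_term a b (c + of_nat n) k) \<le> norm (hyp_term a b (of_real r) k)"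
      using eventually_prodI[OF always_eventually[of "\<lambda>_::nat. True"] eventually_ge_at_top[of n1], of sequentially]
      by (auto elim: eventually_mono simp: case_prod_unfold)
  qed simp
  also have "(\<Sum>k::nat. if k = 0 then 1 else 0 :: complex) = 1"
    using sums_If_finite_set[of "{0::nat}" "\<lambda>_. 1 :: complex"] by (simp add: sums_iff)
  finally show ?thesis .
qed

lemma suminf_hyp_term:
  assumes c: "c \<notin> \<int>\<^sub>\<le>\<^sub>0" and s: "Re (c - a - b) > 0"
  shows "suminf (hyp_term a b c)
       = Gamma c * Gamma (c - a - b) * (rGamma (c - a) * rGamma (c - b))"
proof -
  have s': "c - a - b \<notin> \<int>\<^sub>\<le>\<^sub>0"
    using s by (rule Re_pos_not_nonpos_Int)
  \<comment> \<open>The normalising factors of the four Euler products cancel, as \<open>c + (c - a - b) = (c - a) + (c - b)\<close>.\<close>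
  have eq: "rGamma_series c n * rGamma_series (c - a - b) n * suminf (hyp_term a b c)
      = rGamma_series (c - a) n * rGamma_series (c - b) n * suminf (hyp_term a b (c + of_nat (Suc n)))" for n
  proof -
    define E where "E z = exp (z * complex_of_real (ln (real n)))" for z
    have E: "E c * E (c - a - b) = E (c - a) * E (c - b)" "E z \<noteq> 0" for z
      by (auto simp: E_def algebra_simps simp flip: exp_add)
    show ?thesis
      using suminf_hyp_term_shift[OF c s, of "Suc n"] E
      unfolding rGamma_series_def E_def[symmetric] by (simp add: field_simps)
  qed
  have "(\<lambda>n. rGamma_series c n * rGamma_series (c - a - b) n * suminf (hyp_term a b c))
      \<longlonglongrightarrow> rGamma c * rGamma (c - a - b) * suminf (hyp_term a b c)"
    by (intro tendsto_intros)
  moreover have "(\<lambda>n. rGamma_series c n * rGamma_series (c - a - b) n * suminf (hyp_term a b c))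
      \<longlonglongrightarrow> rGamma (c - a) * rGamma (c - b) * 1"
    unfolding eq by (intro tendsto_intros LIMSEQ_Suc[OF suminf_hyp_term_tendsto_1])
  ultimately have "rGamma c * rGamma (c - a - b) * suminf (hyp_term a b c) = rGamma (c - a) * rGamma (c - b)"
    using LIMSEQ_unique by fastforce
  moreover have "Gamma c * rGamma c = 1" "Gamma (c - a - b) * rGamma (c - a - b) = 1"
    using c s' by (auto simp: rGamma_inverse_Gamma Gamma_eq_zero_iff)
  ultimately show ?thesis by algebra
qed

lemma has_sum_hyp_term:
  assumes c: "c \<notin> \<int>\<^sub>\<le>\<^sub>0" and s: "Re (c - a - b) > 0"
  shows "(hyp_term a b c has_sum
       Gamma c * Gamma (c - a - b) * (rGamma (c - a) * rGamma (c - b))) UNIV"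
  using summable_norm_hyp_term[OF assms] suminf_hyp_term[OF assms]
  by (intro norm_summable_imp_has_sum) (metis summable_norm_cancel summable_sums)+

section \<open>The terminating double series\<close>

lemma pochhammer_neg_of_nat:
  "pochhammer (- of_nat N :: complex) n = (-1) ^ n * fact n * of_nat (N choose n)"
  by (simp add: binomial_gbinomial gbinomial_pochhammer)

lemma chu_vandermonde:
  fixes f x :: complex
  assumes "f \<notin> \<int>\<^sub>\<le>\<^sub>0"
  shows "(\<Sum>n\<le>K. (-1) ^ n * of_nat (K choose n) * (pochhammer x n / pochhammer f n))
       = pochhammer (f - x) K / pochhammer f K"
proof -
  have "\<forall>i\<in>{0..<K}. f \<noteq> - of_nat i" using assms by auto
  from Vandermonde_pochhammer[OF this, of x] show ?thesis
    by (simp add: pochhammer_neg_of_nat atLeast0AtMost mult_ac)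
qed

lemma has_sum_finite_sum:
  fixes f :: "'i \<Rightarrow> 'a \<Rightarrow> complex"
  assumes "finite I" "\<And>i. i \<in> I \<Longrightarrow> (f i has_sum s i) A"
  shows "((\<lambda>x. \<Sum>i\<in>I. f i x) has_sum (\<Sum>i\<in>I. s i)) A"
  using assms by (induction I rule: finite_induct) (auto intro: has_sum_add)

text \<open>
  A polynomial weight of degree \<open>M\<close> in \<open>m\<close> costs \<open>M\<close> in the convergence condition. Writing it in the basis
  \<open>(b + m)\<^sub>j\<close> lets it be absorbed into the upper parameter \<open>b\<close>, whence Gauss's theorem applies to each
  summand.
\<close>
lemma has_sum_pochhammer_hyp_term:
  assumes e: "e \<notin> \<int>\<^sub>\<le>\<^sub>0" and s: "Re (e - b - c) > real M"
  shows "((\<lambda>m. pochhammer (x + of_nat m) M * hyp_term b c e m) has_sum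
     (\<Sum>j\<le>M. of_nat (M choose j) * pochhammer b j * pochhammer (x - b) (M - j)
        * (Gamma e * Gamma (e - (b + of_nat j) - c) * (rGamma (e - (b + of_nat j)) * rGamma (e - c))))) UNIV"
proof -
  have "pochhammer (x + of_nat m) M * hyp_term b c e m
    = (\<Sum>j\<le>M. of_nat (M choose j) * pochhammer b j * pochhammer (x - b) (M - j) * hyp_term (b + of_nat j) c e m)" for m
  proof -
    have 1: "pochhammer (b + of_nat m) j * hyp_term b c e m = pochhammer b j * hyp_term (b + of_nat j) c e m" for j
      using pochhammer_product'[of b j m] pochhammer_product'[of b m j]
      by (simp add: hyp_term_def add.commute)
    have "pochhammer (x + of_nat m) M = (\<Sum>j\<le>M. of_nat (M choose j) * pochhammer (b + of_nat m) j * pochhammer (x - b) (M - j))"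
      using pochhammer_binomial_sum[of "b + of_nat m" "x - b" M] by (simp add: add.commute)
    then have "pochhammer (x + of_nat m) M * hyp_term b c e m
        = (\<Sum>j\<le>M. of_nat (M choose j) * pochhammer (x - b) (M - j) * (pochhammer (b + of_nat m) j * hyp_term b c e m))"
      by (simp add: sum_distrib_left mult_ac)
    then show ?thesis
      unfolding 1 by (simp add: mult_ac)
  qed
  moreover have "((\<lambda>m. \<Sum>j\<le>M. of_nat (M choose j) * pochhammer b j * pochhammer (x - b) (M - j) * hyp_term (b + of_nat j) c e m) has_sum
     (\<Sum>j\<le>M. of_nat (M choose j) * pochhammer b j * pochhammer (x - b) (M - j)
        * (Gamma e * Gamma (e - (b + of_nat j) - c) * (rGamma (e - (b + of_nat j)) * rGamma (e - c))))) UNIV"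
    using s by (intro has_sum_finite_sum has_sum_cmult_right has_sum_hyp_term e) auto
  ultimately show ?thesis by simp
qed

lemma choose_choose_swap:
  assumes "n + j \<le> N"
  shows "(N choose n) * ((N - n) choose j) = (N choose j) * ((N - j) choose n)"
  using choose_mult[of n "n + j" N] choose_mult[of j "n + j" N] binomial_symmetric[of n "n + j"] assms
  by simp

text \<open>
  The crucial point is that \<open>(d - b)\<^sub>n (d - b + n)\<^bsub>N-n-j\<^esub> = (d - b)\<^bsub>N-j\<^esub>\<close>: once the order of summation
  is exchanged, the inner sum over \<open>n\<close> is free of \<open>d\<close> and summable by Chu--Vandermonde. Its value
  supplies \<open>(b + j)\<^bsub>N-j\<^esub>\<close>, which completes \<open>(b)\<^sub>j\<close> to \<open>(b)\<^sub>N\<close>, and \<open>1 / (f)\<^bsub>N-j\<^esub>\<close>, which reduces the Gamma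
  values to ones that do not depend on \<open>j\<close>.
\<close>
lemma double_sum_eval:
  fixes b c d e f :: complex and N :: nat
  defines "f \<equiv> e - b - c - of_nat N"
  assumes f: "f \<notin> \<int>\<^sub>\<le>\<^sub>0"
  shows "(\<Sum>n\<le>N. (-1) ^ n * of_nat (N choose n) * pochhammer (d - b) n * (pochhammer (e - c - 1) n / pochhammer f n)
      * (\<Sum>j\<le>N - n. of_nat ((N - n) choose j) * pochhammer b j * pochhammer (d + of_nat n - b) (N - n - j)
        * (Gamma e * Gamma (e - (b + of_nat j) - c) * (rGamma (e - (b + of_nat j)) * rGamma (e - c)))))
    = pochhammer b N * pochhammer (e - d - of_nat N) N
      * (Gamma e * Gamma f * (rGamma (e - b) * rGamma (e - c)))"
    (is "(\<Sum>n\<le>N. ?A n * (\<Sum>j\<le>N - n. ?B n j)) = _")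
proof -
  define G where "G j = Gamma e * Gamma (e - (b + of_nat j) - c) * (rGamma (e - (b + of_nat j)) * rGamma (e - c))" for j :: nat
  have "(\<Sum>n\<le>N. ?A n * (\<Sum>j\<le>N - n. ?B n j)) = (\<Sum>n\<le>N. \<Sum>j\<le>N - n. ?A n * ?B n j)"
    by (simp add: sum_distrib_left)
  also have "\<dots> = (\<Sum>(n, j)\<in>(SIGMA n:{..N}. {..N - n}). ?A n * ?B n j)"
    by (rule sum.Sigma) auto
  also have "\<dots> = (\<Sum>(j, n)\<in>(SIGMA j:{..N}. {..N - j}). ?A n * ?B n j)"
    by (rule sum.reindex_bij_witness[of _ "\<lambda>(n, j). (j, n)" "\<lambda>(n, j). (j, n)"]) auto
  also have "\<dots> = (\<Sum>j\<le>N. \<Sum>n\<le>N - j. ?A n * ?B n j)"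
    by (rule sum.Sigma[symmetric]) auto
  also have "\<dots> = (\<Sum>j\<le>N. (-1) ^ N * (pochhammer b N * (Gamma e * Gamma f * (rGamma (e - b) * rGamma (e - c))))
       * (of_nat (N choose j) * pochhammer (1 + b - e) j * pochhammer (d - b) (N - j)))"
  proof (intro sum.cong refl)
    fix j assume "j \<in> {..N}"
    then have j: "j \<le> N" by simp
    define K where "K = N - j"
    have N: "N = j + K" using j by (simp add: K_def)
    have "?A n * ?B n j = of_nat (N choose j) * pochhammer b j * G j * pochhammer (d - b) K
        * ((-1) ^ n * of_nat (K choose n) * (pochhammer (e - c - 1) n / pochhammer f n))"
      if "n \<in> {..K}" for n
    proof -
      have "n + j \<le> N" using that by (simp add: N)
      from arg_cong[OF choose_choose_swap[OF this], of "of_nat :: nat \<Rightarrow> complex"]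
      have 1: "of_nat (N choose n) * of_nat ((N - n) choose j) = (of_nat (N choose j) * of_nat (K choose n) :: complex)"
        by (simp add: K_def)
      have 2: "pochhammer (d - b) n * pochhammer (d + of_nat n - b) (N - n - j) = pochhammer (d - b) K"
        using pochhammer_product[of n K "d - b"] that by (simp add: K_def algebra_simps)
      have regroup: "(s * C1 * P1 * Q) * (C2 * p * P2 * g) = C3 * p * g * P * (s * C4 * Q)"
        if "C1 * C2 = C3 * C4" "P1 * P2 = P" for s C1 P1 Q C2 p P2 g C3 P C4 :: complex
        using that by algebra
      show ?thesis unfolding G_def by (rule regroup[OF 1 2])
    qed
    then have "(\<Sum>n\<le>K. ?A n * ?B n j) = of_nat (N choose j) * pochhammer b j * G j * pochhammer (d - b) K
        * (\<Sum>n\<le>K. (-1) ^ n * of_nat (K choose n) * (pochhammer (e - c - 1) n / pochhammer f n))"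
      unfolding sum_distrib_left by (intro sum.cong refl)
    also have "(\<Sum>n\<le>K. (-1) ^ n * of_nat (K choose n) * (pochhammer (e - c - 1) n / pochhammer f n))
        = pochhammer (f - (e - c - 1)) K / pochhammer f K"
      by (rule chu_vandermonde[OF f])
    also have "pochhammer (f - (e - c - 1)) K = (-1) ^ K * pochhammer (b + of_nat j) K"
      using pochhammer_minus'[of "- (b + of_nat j)" K] by (simp add: f_def N algebra_simps)
    finally have S: "(\<Sum>n\<le>K. ?A n * ?B n j) = of_nat (N choose j) * pochhammer b j * G j * pochhammer (d - b) K
        * ((-1) ^ K * pochhammer (b + of_nat j) K / pochhammer f K)" .
    have bN: "pochhammer b N = pochhammer b j * pochhammer (b + of_nat j) K"
      unfolding N by (rule pochhammer_product')
    have "e - (b + of_nat j) - c = f + of_nat K" by (simp add: f_def N)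
    moreover have "Gamma (f + of_nat K) = pochhammer f K * Gamma f"
      using pochhammer_Gamma[OF f, of K] f by (simp add: Gamma_eq_zero_iff)
    moreover have "rGamma (e - (b + of_nat j)) = (-1) ^ j * pochhammer (1 + b - e) j * rGamma (e - b)"
      using pochhammer_rGamma[of "e - (b + of_nat j)" j] pochhammer_minus'[of "e - b - 1" j]
      by (simp add: algebra_simps)
    ultimately have G: "G j = pochhammer f K * ((-1) ^ j * pochhammer (1 + b - e) j * (Gamma e * Gamma f * (rGamma (e - b) * rGamma (e - c))))"
      by (simp add: G_def)
    have "(\<Sum>n\<le>K. ?A n * ?B n j) = (-1) ^ N * (pochhammer b N * (Gamma e * Gamma f * (rGamma (e - b) * rGamma (e - c))))
       * (of_nat (N choose j) * pochhammer (1 + b - e) j * pochhammer (d - b) K)"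
      unfolding S G bN using pochhammer_nonzero[OF f, of K] by (simp add: N power_add)
    then show "(\<Sum>n\<le>N - j. ?A n * ?B n j) = (-1) ^ N * (pochhammer b N * (Gamma e * Gamma f * (rGamma (e - b) * rGamma (e - c))))
       * (of_nat (N choose j) * pochhammer (1 + b - e) j * pochhammer (d - b) (N - j))"
      by (simp only: K_def)
  qed
  also have "\<dots> = (-1) ^ N * (pochhammer b N * (Gamma e * Gamma f * (rGamma (e - b) * rGamma (e - c))))
       * pochhammer ((1 + b - e) + (d - b)) N"
    by (simp only: pochhammer_binomial_sum[of "1 + b - e" "d - b"] sum_distrib_left)
  also have "pochhammer (e - d - of_nat N) N = (-1) ^ N * pochhammer ((1 + b - e) + (d - b)) N"
    using pochhammer_minus'[of "e - d - 1" N] by (simp add: algebra_simps)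
  then have "(-1) ^ N * (pochhammer b N * (Gamma e * Gamma f * (rGamma (e - b) * rGamma (e - c))))
       * pochhammer ((1 + b - e) + (d - b)) N = pochhammer b N * pochhammer (e - d - of_nat N) N
      * (Gamma e * Gamma f * (rGamma (e - b) * rGamma (e - c)))"
    by simp
  finally show ?thesis .
qed

text \<open>
  Both sides of \<open>(d)\<^sub>N (d + N)\<^sub>m = (d)\<^bsub>m+n\<^esub> (d + n + m)\<^bsub>N-n\<^esub>\<close> are \<open>(d)\<^bsub>N+m\<^esub>\<close>. This turns the joint denominator
  into a polynomial weight.
\<close>
lemma kdf_term_eq:
  fixes b c d e f :: complex and N :: nat
  assumes d: "d \<notin> \<int>\<^sub>\<le>\<^sub>0" and n: "n \<le> N"
  shows "kdf_term d (d + of_nat N) b c e (- of_nat N) (d - b) (e - c - 1) f 1 1 (m, n)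
    = inverse (pochhammer d N) * ((-1) ^ n * of_nat (N choose n) * pochhammer (d - b) n * (pochhammer (e - c - 1) n / pochhammer f n))
      * (pochhammer (d + of_nat n + of_nat m) (N - n) * hyp_term b c e m)"
proof -
  have nz: "pochhammer d N \<noteq> 0" "pochhammer d (m + n) \<noteq> 0"
    using pochhammer_nonzero[OF d] by auto
  have "pochhammer d N * pochhammer (d + of_nat N) m = pochhammer d (m + n) * pochhammer (d + of_nat n + of_nat m) (N - n)"
    using pochhammer_product'[of d N m] pochhammer_product'[of d "m + n" "N - n"] n
    by (simp add: add_ac)
  then have "pochhammer (d + of_nat N) m / pochhammer d (m + n)
      = inverse (pochhammer d N) * pochhammer (d + of_nat n + of_nat m) (N - n)"
    using nz by (simp add: field_simps)
  moreover have "kdf_term d (d + of_nat N) b c e (- of_nat N) (d - b) (e - c - 1) f 1 1 (m, n)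
      = (pochhammer (d + of_nat N) m / pochhammer d (m + n)) * hyp_term b c e m
        * ((-1) ^ n * of_nat (N choose n) * pochhammer (d - b) n * (pochhammer (e - c - 1) n / pochhammer f n))"
    by (simp add: kdf_term_def hyp_term_def pochhammer_neg_of_nat mult_ac)
  ultimately show ?thesis by (simp add: mult_ac)
qed

lemma has_sum_kdf_term:
  fixes b c d e f :: complex and N :: nat
  defines "f \<equiv> e - b - c - of_nat N"
  assumes d: "d \<notin> \<int>\<^sub>\<le>\<^sub>0" and e: "e \<notin> \<int>\<^sub>\<le>\<^sub>0" and conv: "Re f > 0"
  shows "(kdf_term d (d + of_nat N) b c e (- of_nat N) (d - b) (e - c - 1) f 1 1 has_sum
     inverse (pochhammer d N) * (pochhammer b N * pochhammer (e - d - of_nat N) N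
      * (Gamma e * Gamma f * (rGamma (e - b) * rGamma (e - c))))) UNIV"
    (is "(?t has_sum _) UNIV")
proof -
  let ?A = "\<lambda>n. (-1) ^ n * of_nat (N choose n) * pochhammer (d - b) n * (pochhammer (e - c - 1) n / pochhammer f n)"
  let ?S = "\<lambda>n. \<Sum>j\<le>N - n. of_nat ((N - n) choose j) * pochhammer b j * pochhammer (d + of_nat n - b) (N - n - j)
        * (Gamma e * Gamma (e - (b + of_nat j) - c) * (rGamma (e - (b + of_nat j)) * rGamma (e - c)))"
  have f: "f \<notin> \<int>\<^sub>\<le>\<^sub>0" using conv by (rule Re_pos_not_nonpos_Int)
  have inner: "(?t has_sum inverse (pochhammer d N) * ?A n * ?S n) (range (\<lambda>m. (m, n)))" if n: "n \<in> {..N}" for n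
  proof -
    have "((\<lambda>m. inverse (pochhammer d N) * ?A n * (pochhammer (d + of_nat n + of_nat m) (N - n) * hyp_term b c e m))
       has_sum inverse (pochhammer d N) * ?A n * ?S n) UNIV"
      using conv n by (intro has_sum_cmult_right has_sum_pochhammer_hyp_term e) (auto simp: f_def of_nat_diff)
    moreover have "?t \<circ> (\<lambda>m. (m, n))
        = (\<lambda>m. inverse (pochhammer d N) * ?A n * (pochhammer (d + of_nat n + of_nat m) (N - n) * hyp_term b c e m))"
      using n by (simp only: o_def kdf_term_eq[OF d] atMost_iff)
    ultimately have "(?t \<circ> (\<lambda>m. (m, n)) has_sum inverse (pochhammer d N) * ?A n * ?S n) UNIV"
      by (simp only:)
    moreover have "inj (\<lambda>m. (m, n))" by (simp add: inj_on_def)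
    ultimately show ?thesis by (rule has_sum_reindex[THEN iffD2, rotated])
  qed
  have sum: "(?t has_sum (\<Sum>n\<le>N. inverse (pochhammer d N) * ?A n * ?S n)) (\<Union>n\<in>{..N}. range (\<lambda>m. (m, n)))"
    by (rule sum_has_sum[OF finite_atMost inner]) blast+
  have zero: "?t p = 0" if p: "p \<notin> (\<Union>n\<in>{..N}. range (\<lambda>m. (m, n)))" for p
  proof -
    obtain m n where mn: "p = (m, n)" by fastforce
    then have "n > N" using p by (auto simp: not_le[symmetric])
    then show "?t p = 0" by (simp add: mn kdf_term_def pochhammer_of_nat_eq_0_lemma)
  qed
  have "(?t has_sum (\<Sum>n\<le>N. inverse (pochhammer d N) * ?A n * ?S n)) UNIV"
    by (rule has_sum_cong_neutral[THEN iffD1, OF _ _ _ sum]) (simp_all only: zero Diff_iff simp_thms UNIV_I)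
  moreover have "(\<Sum>n\<le>N. inverse (pochhammer d N) * ?A n * ?S n) = inverse (pochhammer d N) * (\<Sum>n\<le>N. ?A n * ?S n)"
    by (simp only: sum_distrib_left mult.assoc)
  moreover have "(\<Sum>n\<le>N. ?A n * ?S n) = pochhammer b N * pochhammer (e - d - of_nat N) N
      * (Gamma e * Gamma f * (rGamma (e - b) * rGamma (e - c)))"
    using f unfolding f_def by (rule double_sum_eval)
  ultimately show ?thesis by (simp only:)
qed

lemma Gamma_reflected_ratio:
  assumes "1 - x \<notin> (\<int>\<^sub>\<le>\<^sub>0 :: complex set)"
  shows "Gamma (1 - x) * rGamma (1 - x - of_nat N) = (-1) ^ N * pochhammer x N"
proof -
  have "rGamma (1 - x - of_nat N) = (-1) ^ N * pochhammer x N * rGamma (1 - x)"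
    using pochhammer_rGamma[of "1 - x - of_nat N" N] pochhammer_minus'[of "- x" N] by (simp add: algebra_simps)
  then show ?thesis using assms by (simp add: rGamma_inverse_Gamma Gamma_eq_zero_iff)
qed

text \<open>
  It remains to translate Pochhammer symbols into Gamma quotients. When \<open>1 + d - a - b\<close> or \<open>e - a\<close> is
  a pole of Gamma, both descriptions give \<open>0\<close>; working with the entire function \<^const>\<open>rGamma\<close> avoids
  treating these cases separately.
\<close>
lemma kdf_eval:
  fixes a b c d e :: complex
  assumes conv: "Re (d + e - a - b - c) > 0"
    and N: "d - a = - of_nat N"
    and d: "d \<notin> \<int>\<^sub>\<le>\<^sub>0" and e: "e \<notin> \<int>\<^sub>\<le>\<^sub>0"
    and num: "1 - a \<notin> \<int>\<^sub>\<le>\<^sub>0" "1 - b \<notin> \<int>\<^sub>\<le>\<^sub>0" "e - d \<notin> \<int>\<^sub>\<le>\<^sub>0"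
  shows "(kdf_term d a b c e (d - a) (d - b) (e - c - 1) (d + e - a - b - c) 1 1 has_sum
      (Gamma (1 - a) * Gamma (1 - b) * Gamma e * Gamma (e - d) * Gamma (d + e - a - b - c))
        / (Gamma (1 - d) * Gamma (e - a) * Gamma (e - b) * Gamma (e - c) * Gamma (1 + d - a - b))) UNIV"
proof -
  have a: "a = d + of_nat N" using N by (simp add: algebra_simps)
  have f: "d + e - a - b - c = e - b - c - of_nat N" by (simp add: a)
  have d1: "1 - d \<notin> \<int>\<^sub>\<le>\<^sub>0"
    using add_of_nat_not_nonpos_Int[OF num(1), of N] by (simp add: a)
  have "Gamma (1 - d) * rGamma (1 - a) = (-1) ^ N * pochhammer d N"
    using Gamma_reflected_ratio[of d N] d1 by (simp add: a diff_diff_eq)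
  then have 1: "Gamma (1 - a) / Gamma (1 - d) = (-1) ^ N * inverse (pochhammer d N)"
    using d1 num(1) pochhammer_nonzero[OF d, of N]
    by (auto simp: rGamma_inverse_Gamma Gamma_eq_zero_iff field_simps)
  have 2: "Gamma (1 - b) * rGamma (1 + d - a - b) = (-1) ^ N * pochhammer b N"
    using Gamma_reflected_ratio[of b N] num(2) by (simp add: a algebra_simps)
  have 3: "Gamma (e - d) * rGamma (e - a) = pochhammer (e - d - of_nat N) N"
    using pochhammer_rGamma[of "e - a" N] num(3)
    by (simp add: a diff_diff_eq rGamma_inverse_Gamma Gamma_eq_zero_iff)
  have "(Gamma (1 - a) * Gamma (1 - b) * Gamma e * Gamma (e - d) * Gamma (d + e - a - b - c))
        / (Gamma (1 - d) * Gamma (e - a) * Gamma (e - b) * Gamma (e - c) * Gamma (1 + d - a - b))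
     = (Gamma (1 - a) / Gamma (1 - d)) * (Gamma (1 - b) * rGamma (1 + d - a - b)) * (Gamma (e - d) * rGamma (e - a))
        * (Gamma e * Gamma (d + e - a - b - c) * (rGamma (e - b) * rGamma (e - c)))"
    by (simp add: rGamma_inverse_Gamma divide_inverse)
  also have "\<dots> = inverse (pochhammer d N) * (pochhammer b N * pochhammer (e - d - of_nat N) N
      * (Gamma e * Gamma (d + e - a - b - c) * (rGamma (e - b) * rGamma (e - c))))"
    unfolding 1 2 3 by simp
  finally show ?thesis
    using has_sum_kdf_term[OF d e, of b c N] conv unfolding f N unfolding a by simp
qed

theorem mainTheorem6:
  fixes a b c d e :: complex
  assumes conv: "Re (d + e - a - b - c) > 0"
    and neg_int: "(\<exists>N::nat. N \<ge> 1 \<and> d - a = - of_nat N) \<or> (\<exists>N::nat. N \<ge> 1 \<and> d - b = - of_nat N)"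
    and d: "d \<notin> \<int>\<^sub>\<le>\<^sub>0"
    and e: "e \<notin> \<int>\<^sub>\<le>\<^sub>0"
    and e': "d + e - a - b - c \<notin> \<int>\<^sub>\<le>\<^sub>0"
    and num: "1 - a \<notin> \<int>\<^sub>\<le>\<^sub>0" "1 - b \<notin> \<int>\<^sub>\<le>\<^sub>0" "e - d \<notin> \<int>\<^sub>\<le>\<^sub>0"
  shows "(\<lambda>p. norm (kdf_term d a b c e (d - a) (d - b) (e - c - 1) (d + e - a - b - c) 1 1 p)) summable_on UNIV
    \<and> kdf d a b c e (d - a) (d - b) (e - c - 1) (d + e - a - b - c) 1 1
      = (Gamma (1 - a) * Gamma (1 - b) * Gamma e * Gamma (e - d) * Gamma (d + e - a - b - c))
        / (Gamma (1 - d) * Gamma (e - a) * Gamma (e - b) * Gamma (e - c) * Gamma (1 + d - a - b))"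
proof -
  have "(kdf_term d a b c e (d - a) (d - b) (e - c - 1) (d + e - a - b - c) 1 1 has_sum
      (Gamma (1 - a) * Gamma (1 - b) * Gamma e * Gamma (e - d) * Gamma (d + e - a - b - c))
        / (Gamma (1 - d) * Gamma (e - a) * Gamma (e - b) * Gamma (e - c) * Gamma (1 + d - a - b))) UNIV"
    using neg_int
  proof (elim disjE exE conjE)
    fix N assume "d - a = - of_nat N"
    then show ?thesis by (rule kdf_eval[OF conv _ d e num])
  next
    fix N assume N: "d - b = - of_nat N"
    have sym: "d + e - b - a - c = d + e - a - b - c" "1 + d - b - a = 1 + d - a - b" by simp_all
    have "kdf_term d b a c e (d - b) (d - a) (e - c - 1) f 1 1 = kdf_term d a b c e (d - a) (d - b) (e - c - 1) f 1 1" for f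
      by (simp add: kdf_term_def mult_ac)
    then show ?thesis
      using kdf_eval[OF _ N d e num(2,1,3), of c] conv by (simp only: sym mult_ac)
  qed
  then show ?thesis
    by (metis kdf_def infsumI has_sum_imp_summable summable_on_iff_abs_summable_on_complex)
qed

end
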